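(* Let $r$, $w$, $t$, $d_0$ be positive integers with $w\le r$ and $t\ge r+w$, and let $d=\frac{B(I_t(r,w))}{|E(I_t(r,w))|}\,t!$. Then $$N((r,w;d_0d),t)=d_0\,(t!).$$
   Context: Write $[t]=\{1,\dots,t\}$. A set system $(X,\mathcal B)$ with $|X|=n$ and an indexed family of blocks $\mathcal B=\{B_1,\dots,B_t\}$ of subsets of $X$ is an $(r,w;d)-CFF(n,t)$ (cover-free family) if for all $L,M\subseteq[t]$ with $L\cap M=\varnothing$, $|L|=r$, $|M|=w$, we have $\left|\left(\bigcap_{l\in L}B_l\right)\setminus\left(\bigcup_{m\in M}B_m\right)\right|\ge d$. $N((r,w;d),t)$ denotes the minimum $n$ for which an $(r,w;d)-CFF(n,t)$ exists. For $0<w\le r\le t$, the bi-intersection graph $I_t(r,w)$ is the bipartite graph with one part consisting of all $r$-subsets of $[t]$ and the other part of all $w$-subsets of $[t]$ (two disjoint parts, even when $r=w$), where a $w$-subset is adjacent to an $r$-subset if and only if their intersection is empty. $E(G)$ is the edge set of $G$. A biclique is a bipartite graph with vertex set $(X,Y)$ in which every vertex of $X$ is adjacent to every vertex of $Y$. For a graph $G$, $B(G)$ is the maximum number of edges among the bicliques of $G$ (i.e. subgraphs of $G$ that are bicliques). *)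

theory Defs
  imports Complex_Main
begin

record 'v ugraph =
  verts :: "'v set"
  edges :: "'v set set"

definition subgraph :: "'v ugraph \<Rightarrow> 'v ugraph \<Rightarrow> bool" where
  "subgraph H G \<longleftrightarrow> verts H \<subseteq> verts G \<and> edges H \<subseteq> edges G"

definition bipartite_with :: "'v ugraph \<Rightarrow> 'v set \<Rightarrow> 'v set \<Rightarrow> bool" where
  "bipartite_with G X Y \<longleftrightarrow>
     verts G = X \<union> Y \<and> X \<inter> Y = {} \<and> edges G \<subseteq> {{x, y} |x y. x \<in> X \<and> y \<in> Y}"

definition biclique :: "'v ugraph \<Rightarrow> bool" where
  "biclique G \<longleftrightarrow> (\<exists>X Y. bipartite_with G X Y \<and> (\<forall>x\<in>X. \<forall>y\<in>Y. {x, y} \<in> edges G))"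

(* Meaningful for finite G only. The set is then finite, and nonempty because the empty
   graph is a biclique. *)
definition max_biclique_edges :: "'v ugraph \<Rightarrow> nat" where
  "max_biclique_edges G = Max {card (edges H) |H. biclique H \<and> subgraph H G}"

definition subsets_of_size :: "nat \<Rightarrow> nat \<Rightarrow> nat set set" where
  "subsets_of_size t k = {A. A \<subseteq> {1..t} \<and> card A = k}"

(* The sum type keeps the two parts disjoint even when r = w. *)
definition bi_intersection_graph :: "nat \<Rightarrow> nat \<Rightarrow> nat \<Rightarrow> (nat set + nat set) ugraph" where
  "bi_intersection_graph t r w =
     \<lparr>verts = Inl ` subsets_of_size t r \<union> Inr ` subsets_of_size t w,
      edges = {{Inl R, Inr W} |R W.
        R \<in> subsets_of_size t r \<and> W \<in> subsets_of_size t w \<and> R \<inter> W = {}}\<rparr>"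

(* The blocks are B 1, ..., B t, possibly with repetitions. The threshold d is real so that it
   can be given as a quotient. For r = 0 the intersection would be UNIV rather than X;
   only r > 0 is intended. *)
definition cover_free_family ::
  "nat \<Rightarrow> nat \<Rightarrow> real \<Rightarrow> nat \<Rightarrow> nat \<Rightarrow> 'a set \<Rightarrow> (nat \<Rightarrow> 'a set) \<Rightarrow> bool" where
  "cover_free_family r w d n t X B \<longleftrightarrow>
     finite X \<and> card X = n \<and> (\<forall>i\<in>{1..t}. B i \<subseteq> X) \<and>
     (\<forall>L M. L \<subseteq> {1..t} \<and> M \<subseteq> {1..t} \<and> L \<inter> M = {} \<and> card L = r \<and> card M = w \<longrightarrow>
        real (card ((\<Inter>l\<in>L. B l) - (\<Union>m\<in>M. B m))) \<ge> d)"

(* Every finite point set can be relabelled by natural numbers, so points of type nat suffice. *)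
definition cff_number :: "nat \<Rightarrow> nat \<Rightarrow> real \<Rightarrow> nat \<Rightarrow> nat" where
  "cff_number r w d t =
     (LEAST n. \<exists>(X :: nat set) B. cover_free_family r w d n t X B)"

end

theory Submission
  imports Defs "HOL-Combinatorics.Permutations"
begin

text \<open>
  Everything rests on one observation: the points of a set system are bicliques
  of the bi-intersection graph. A point \<open>x\<close> lies in the blocks with indices in some set
  \<open>S \<subseteq> [t]\<close>, and it is counted for the pair \<open>(L, M)\<close> exactly when \<open>L \<subseteq> S\<close> and
  \<open>M \<inter> S = \<emptyset>\<close>. These pairs are the edges of a biclique, and conversely the edges of
  every biclique are among those that arise from such an \<open>S\<close> (take the union of its \<open>r\<close>-subsets). Hence
  \<open>B(I\<^sub>t(r,w))\<close> is the largest number of pairs that one index set \<open>S\<close> can separate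
  (lemmas \<open>card_separated_le_max_biclique\<close> and \<open>max_biclique_eq_card_separated\<close>).

  Count incidences between points and the pairs that they separate. In a cover-free family each
  of the \<open>|E|\<close> pairs is separated by at least \<open>d\<^sub>0 d\<close> points, and each point separates at most
  \<open>B(I\<^sub>t(r,w))\<close> pairs, so \<open>n B(I\<^sub>t(r,w)) \<ge> d\<^sub>0 d |E| = d\<^sub>0 t! B(I\<^sub>t(r,w))\<close>. Equality is reached
  by taking an optimal \<open>S\<close> together with all its preimages under the symmetric group: the
  points are the permutations of \<open>[t]\<close>, each repeated \<open>d\<^sub>0\<close> times, and every one of them
  separates \<open>B(I\<^sub>t(r,w))\<close> pairs. Since the symmetric group acts transitively on
  the disjoint pairs, every pair is separated equally often, which forces the average \<open>d\<^sub>0 d\<close>.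
\<close>

section \<open>Disjoint pairs and separation\<close>

definition disjoint_pairs :: "nat \<Rightarrow> nat \<Rightarrow> nat \<Rightarrow> (nat set \<times> nat set) set" where
  "disjoint_pairs t r w =
     {(L, M). L \<in> subsets_of_size t r \<and> M \<in> subsets_of_size t w \<and> L \<inter> M = {}}"

definition separates :: "'a set \<Rightarrow> 'a set \<times> 'a set \<Rightarrow> bool" where
  "separates S p \<longleftrightarrow> fst p \<subseteq> S \<and> snd p \<inter> S = {}"

definition pair_edge :: "nat set \<times> nat set \<Rightarrow> (nat set + nat set) set" where
  "pair_edge p = {Inl (fst p), Inr (snd p)}"

lemma inj_pair_edge: "inj pair_edge"
  by (auto simp: inj_def pair_edge_def doubleton_eq_iff)

lemma finite_disjoint_pairs: "finite (disjoint_pairs t r w)"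
proof (rule finite_subset)
  show "disjoint_pairs t r w \<subseteq> Pow {1..t} \<times> Pow {1..t}"
    by (auto simp: disjoint_pairs_def subsets_of_size_def)
qed simp

lemma disjoint_pairs_nonempty:
  assumes "r + w \<le> t"
  shows "disjoint_pairs t r w \<noteq> {}"
proof -
  have "({1..r}, {r+1..r+w}) \<in> disjoint_pairs t r w"
    using assms by (auto simp: disjoint_pairs_def subsets_of_size_def)
  then show ?thesis by blast
qed

lemma edges_bi_intersection_graph:
  "edges (bi_intersection_graph t r w) = pair_edge ` disjoint_pairs t r w"
  by (simp add: bi_intersection_graph_def disjoint_pairs_def pair_edge_def image_def Bex_def conj_ac)

lemma card_edges_bi_intersection_graph:
  "card (edges (bi_intersection_graph t r w)) = card (disjoint_pairs t r w)"
  unfolding edges_bi_intersection_graph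
  by (rule card_image) (rule inj_on_subset[OF inj_pair_edge subset_UNIV])

section \<open>Bicliques are index sets\<close>

lemma finite_biclique_sizes:
  assumes "finite (edges G)"
  shows "finite {card (edges H) |H. biclique H \<and> subgraph H G}"
proof (rule finite_subset)
  show "{card (edges H) |H. biclique H \<and> subgraph H G} \<subseteq> card ` Pow (edges G)"
    unfolding subgraph_def by blast
  show "finite (card ` Pow (edges G))"
    using assms by simp
qed

text \<open>
  The pairs separated by \<open>S\<close> combine any \<open>r\<close>-subset inside \<open>S\<close> with any \<open>w\<close>-subset outside \<open>S\<close>;
  such subsets are automatically disjoint, so these pairs are the edges of a biclique.
\<close>

lemma card_separated_le_max_biclique:
  "card {p \<in> disjoint_pairs t r w. separates S p}
     \<le> max_biclique_edges (bi_intersection_graph t r w)"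
proof -
  let ?G = "bi_intersection_graph t r w"
  let ?Q = "{p \<in> disjoint_pairs t r w. separates S p}"
  let ?X = "Inl ` {R \<in> subsets_of_size t r. R \<subseteq> S} :: (nat set + nat set) set"
  let ?Y = "Inr ` {W \<in> subsets_of_size t w. W \<inter> S = {}} :: (nat set + nat set) set"
  let ?H = "\<lparr>verts = ?X \<union> ?Y, edges = pair_edge ` ?Q\<rparr> :: (nat set + nat set) ugraph"
  have "bipartite_with ?H ?X ?Y"
    by (auto simp: bipartite_with_def pair_edge_def separates_def disjoint_pairs_def) blast
  moreover have "{x, y} \<in> edges ?H" if xy: "x \<in> ?X" "y \<in> ?Y" for x y
  proof -
    obtain R W where "x = Inl R" "y = Inr W" "R \<in> subsets_of_size t r" "R \<subseteq> S"
      "W \<in> subsets_of_size t w" "W \<inter> S = {}"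
      using xy by auto
    then have "{x, y} = pair_edge (R, W)" "(R, W) \<in> ?Q"
      by (auto simp: pair_edge_def separates_def disjoint_pairs_def)
    then show ?thesis by auto
  qed
  ultimately have "biclique ?H" unfolding biclique_def by blast
  moreover have "subgraph ?H ?G"
    unfolding subgraph_def edges_bi_intersection_graph
    by (auto simp: bi_intersection_graph_def)
  moreover have "card (edges ?H) = card ?Q"
    using card_image[OF inj_on_subset[OF inj_pair_edge subset_UNIV]] by simp
  ultimately have "card ?Q \<in> {card (edges H) |H. biclique H \<and> subgraph H ?G}"
    by (metis (mono_tags, lifting) mem_Collect_eq)
  then show ?thesis
    unfolding max_biclique_edges_def
    using finite_biclique_sizes[of ?G] finite_disjoint_pairs
    by (intro Max_ge) (auto simp: edges_bi_intersection_graph)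
qed

text \<open>
  The sides of a biclique need not be labelled consistently with the two parts of the graph, but
  two edges with opposite orientation would force an edge between two \<open>r\<close>-subsets.
  So edges can be recombined, and the union of the \<open>r\<close>-subsets avoids every \<open>w\<close>-subset.
\<close>

lemma biclique_separated_by_index_set:
  assumes "biclique H" and sub: "subgraph H (bi_intersection_graph t r w)"
  obtains S where "edges H \<subseteq> pair_edge ` {p \<in> disjoint_pairs t r w. separates S p}"
proof -
  obtain X Y where HXY: "edges H \<subseteq> {{x, y} |x y. x \<in> X \<and> y \<in> Y}"
    and comp: "\<And>x y. x \<in> X \<Longrightarrow> y \<in> Y \<Longrightarrow> {x, y} \<in> edges H"
    using assms(1) unfolding biclique_def bipartite_with_def by (elim exE conjE) blast
  have HG: "edges H \<subseteq> pair_edge ` disjoint_pairs t r w"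
    using sub unfolding subgraph_def edges_bi_intersection_graph by simp
  have orient: "Inl R \<in> X \<and> Inr W \<in> Y \<or> Inr W \<in> X \<and> Inl R \<in> Y"
    if e: "pair_edge (R, W) \<in> edges H" for R W
  proof -
    obtain x y where "pair_edge (R, W) = {x, y}" "x \<in> X" "y \<in> Y"
      using subsetD[OF HXY e] by blast
    then show ?thesis by (auto simp: pair_edge_def doubleton_eq_iff)
  qed
  have no_left: "{Inl R, Inl R'} \<notin> edges H" for R R'
  proof
    assume "{Inl R, Inl R'} \<in> edges H"
    then obtain p where "{Inl R, Inl R'} = pair_edge p" using HG by blast
    then show False by (simp add: pair_edge_def doubleton_eq_iff)
  qed
  have recombine: "pair_edge (R', W) \<in> edges H"
    if e: "pair_edge (R, W) \<in> edges H" and e': "pair_edge (R', W') \<in> edges H" for R W R' W'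
  proof -
    have "{Inl R', Inr W} \<in> edges H \<or> {Inr W, Inl R'} \<in> edges H"
      using orient[OF e] orient[OF e'] comp no_left by blast
    then show ?thesis by (simp add: pair_edge_def insert_commute)
  qed
  have pair_mem: "p \<in> disjoint_pairs t r w" if "pair_edge p \<in> edges H" for p
    using HG that by (metis (no_types) subsetD inj_image_mem_iff inj_pair_edge)
  define S where "S = \<Union>{R. \<exists>W. pair_edge (R, W) \<in> edges H}"
  have "edges H \<subseteq> pair_edge ` {p \<in> disjoint_pairs t r w. separates S p}"
  proof
    fix e assume e: "e \<in> edges H"
    then obtain R W where RW: "e = pair_edge (R, W)" "(R, W) \<in> disjoint_pairs t r w"
      using HG by auto
    have "R' \<inter> W = {}" if "pair_edge (R', W') \<in> edges H" for R' W'
      using pair_mem[OF recombine[OF e[unfolded RW(1)] that]] by (simp add: disjoint_pairs_def)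
    then have "separates S (R, W)"
      using e RW(1) unfolding separates_def S_def fst_conv snd_conv by blast
    then show "e \<in> pair_edge ` {p \<in> disjoint_pairs t r w. separates S p}"
      using RW by blast
  qed
  then show thesis by (rule that)
qed

text \<open>
  The index set of an optimal biclique separates at least as many pairs as the biclique has edges,
  and by optimality no more.
\<close>

lemma max_biclique_eq_card_separated:
  obtains S where "max_biclique_edges (bi_intersection_graph t r w)
           = card {p \<in> disjoint_pairs t r w. separates S p}"
proof -
  let ?G = "bi_intersection_graph t r w"
  let ?sizes = "{card (edges H) |H. biclique H \<and> subgraph H ?G}"
  let ?empty = "\<lparr>verts = {}, edges = {}\<rparr> :: (nat set + nat set) ugraph"
  have "biclique ?empty" "subgraph ?empty ?G"
    by (auto simp: biclique_def bipartite_with_def subgraph_def)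
  then have "?sizes \<noteq> {}" by blast
  moreover have "finite ?sizes"
    using finite_disjoint_pairs
    by (intro finite_biclique_sizes) (simp add: edges_bi_intersection_graph)
  ultimately have "max_biclique_edges ?G \<in> ?sizes"
    unfolding max_biclique_edges_def by (rule Max_in[rotated])
  then obtain H where H: "biclique H" "subgraph H ?G" "max_biclique_edges ?G = card (edges H)"
    by blast
  from biclique_separated_by_index_set[OF H(1,2)] obtain S where S:
    "edges H \<subseteq> pair_edge ` {p \<in> disjoint_pairs t r w. separates S p}" .
  have fin: "finite {p \<in> disjoint_pairs t r w. separates S p}"
    using finite_disjoint_pairs by simp
  have "card (edges H) \<le> card {p \<in> disjoint_pairs t r w. separates S p}"
    using card_mono[OF finite_imageI[OF fin] S] card_image_le[OF fin] le_trans by blast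
  then show thesis
    using that[of S] H(3) card_separated_le_max_biclique[of t r w S] by simp
qed

lemma max_biclique_pos:
  assumes "r + w \<le> t"
  shows "0 < max_biclique_edges (bi_intersection_graph t r w)"
proof -
  obtain p where p: "p \<in> disjoint_pairs t r w"
    using disjoint_pairs_nonempty[OF assms] by blast
  \<comment> \<open>The \<open>r\<close>-subset of any disjoint pair is an index set that separates that pair.\<close>
  then have "separates (fst p) p"
    by (auto simp: separates_def disjoint_pairs_def)
  then have "0 < card {q \<in> disjoint_pairs t r w. separates (fst p) q}"
    using p finite_disjoint_pairs[of t r w] card_gt_0_iff by fastforce
  then show ?thesis
    using card_separated_le_max_biclique[of t r w "fst p"] by simp
qed

section \<open>Double counting\<close>

lemma sum_card_filter_swap:
  assumes "finite X" "finite P"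
  shows "(\<Sum>p\<in>P. card {x \<in> X. Q x p}) = (\<Sum>x\<in>X. card {p \<in> P. Q x p})"
proof -
  have "(\<Sum>p\<in>P. card {x \<in> X. Q x p}) = (\<Sum>p\<in>P. \<Sum>x\<in>X. if Q x p then 1 else 0)"
    using assms(1) by (intro sum.cong) (auto simp flip: sum.inter_filter)
  also have "\<dots> = (\<Sum>x\<in>X. \<Sum>p\<in>P. if Q x p then 1 else 0)"
    by (rule sum.swap)
  also have "\<dots> = (\<Sum>x\<in>X. card {p \<in> P. Q x p})"
    using assms(2) by (intro sum.cong) (auto simp flip: sum.inter_filter)
  finally show ?thesis .
qed

lemma cover_free_region_eq_separating_points:
  assumes "\<And>i. i \<in> {1..t} \<Longrightarrow> B i \<subseteq> X" and "0 < r" and "(L, M) \<in> disjoint_pairs t r w"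
  shows "(\<Inter>l\<in>L. B l) - (\<Union>m\<in>M. B m) = {x \<in> X. separates {i \<in> {1..t}. x \<in> B i} (L, M)}"
proof -
  have LM: "L \<subseteq> {1..t}" "M \<subseteq> {1..t}" "L \<noteq> {}"
    using assms(2,3) by (auto simp: disjoint_pairs_def subsets_of_size_def)
  have "x \<in> X" if "x \<in> (\<Inter>l\<in>L. B l)" for x
    using LM that assms(1) by blast
  then show ?thesis
    unfolding separates_def fst_conv snd_conv
    using LM(1,2) by (auto simp: subset_iff)
qed

text \<open>
  Positivity of \<open>r\<close> is what keeps the intersection of the blocks inside the point set.
\<close>

lemma cover_free_family_iff_separating_points:
  assumes "0 < r"
  shows "cover_free_family r w d n t X B \<longleftrightarrow>
    finite X \<and> card X = n \<and> (\<forall>i\<in>{1..t}. B i \<subseteq> X) \<and>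
    (\<forall>p\<in>disjoint_pairs t r w. d \<le> real (card {x \<in> X. separates {i \<in> {1..t}. x \<in> B i} p}))"
proof (cases "\<forall>i\<in>{1..t}. B i \<subseteq> X")
  case True
  have "(\<Inter>l\<in>L. B l) - (\<Union>m\<in>M. B m) = {x \<in> X. separates {i \<in> {1..t}. x \<in> B i} (L, M)}"
    if "(L, M) \<in> disjoint_pairs t r w" for L M
    using True by (intro cover_free_region_eq_separating_points[OF _ assms that]) simp
  moreover have "(\<forall>p\<in>disjoint_pairs t r w. P p) \<longleftrightarrow>
      (\<forall>L M. L \<subseteq> {1..t} \<and> M \<subseteq> {1..t} \<and> L \<inter> M = {} \<and> card L = r \<and> card M = w \<longrightarrow> P (L, M))"
    for P
    unfolding disjoint_pairs_def subsets_of_size_def by blast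
  moreover have "(L, M) \<in> disjoint_pairs t r w"
    if "L \<subseteq> {1..t} \<and> M \<subseteq> {1..t} \<and> L \<inter> M = {} \<and> card L = r \<and> card M = w" for L M
    using that by (simp add: disjoint_pairs_def subsets_of_size_def)
  ultimately show ?thesis
    unfolding cover_free_family_def by simp
next
  case False
  then show ?thesis unfolding cover_free_family_def by blast
qed

lemma cover_free_family_size_bound:
  fixes d :: real
  assumes cff: "cover_free_family r w d n t X B" and "0 < r"
  shows "d * card (disjoint_pairs t r w)
           \<le> real n * max_biclique_edges (bi_intersection_graph t r w)"
proof -
  let ?P = "disjoint_pairs t r w"
  let ?S = "\<lambda>x. {i \<in> {1..t}. x \<in> B i}"
  let ?b = "max_biclique_edges (bi_intersection_graph t r w)"
  note X = cff[unfolded cover_free_family_iff_separating_points[OF \<open>0 < r\<close>]]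
  have "d * card ?P = (\<Sum>p\<in>?P. d)" by simp
  also have "\<dots> \<le> (\<Sum>p\<in>?P. real (card {x \<in> X. separates (?S x) p}))"
    using X by (intro sum_mono) blast
  also have "\<dots> = real (\<Sum>x\<in>X. card {p \<in> ?P. separates (?S x) p})"
    using X sum_card_filter_swap[of X ?P] finite_disjoint_pairs by (simp flip: of_nat_sum)
  also have "\<dots> \<le> real (\<Sum>x\<in>X. ?b)"
    by (intro of_nat_mono sum_mono card_separated_le_max_biclique)
  also have "\<dots> = real n * ?b" using X by simp
  finally show ?thesis .
qed

section \<open>The symmetric construction\<close>

lemma permutation_between_disjoint_pairs:
  assumes "(L, M) \<in> disjoint_pairs t r w" "(L', M') \<in> disjoint_pairs t r w"
  obtains \<sigma> where "\<sigma> permutes {1..t}" "\<sigma> ` L = L'" "\<sigma> ` M = M'"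
proof -
  have sub: "L \<subseteq> {1..t}" "M \<subseteq> {1..t}" "L' \<subseteq> {1..t}" "M' \<subseteq> {1..t}"
    and disj: "L \<inter> M = {}" "L' \<inter> M' = {}"
    and cards: "card L = card L'" "card M = card M'"
    using assms by (auto simp: disjoint_pairs_def subsets_of_size_def)
  note fin = sub[THEN finite_subset, OF finite_atLeastAtMost]
  let ?R = "{1..t} - (L \<union> M)" and ?R' = "{1..t} - (L' \<union> M')"
  have "card ?R = card ?R'"
    using sub disj cards fin by (simp add: card_Diff_subset card_Un_disjoint)
  then obtain f g h where f: "bij_betw f L L'" and g: "bij_betw g M M'" and h: "bij_betw h ?R ?R'"
    using finite_same_card_bij[of L L'] finite_same_card_bij[of M M']
      finite_same_card_bij[of ?R ?R'] cards fin by auto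
  define \<sigma> where "\<sigma> i = (if i \<in> L then f i else if i \<in> M then g i
    else if i \<in> {1..t} then h i else i)" for i
  have bL: "bij_betw \<sigma> L L'"
    using f by (rule bij_betw_cong[THEN iffD1, rotated]) (simp add: \<sigma>_def)
  have bM: "bij_betw \<sigma> M M'"
    using g disj by (intro bij_betw_cong[THEN iffD1, OF _ g]) (auto simp: \<sigma>_def)
  have bR: "bij_betw \<sigma> ?R ?R'"
    by (intro bij_betw_cong[THEN iffD1, OF _ h]) (auto simp: \<sigma>_def)
  have "bij_betw \<sigma> (L \<union> M \<union> ?R) (L' \<union> M' \<union> ?R')"
    using disj by (intro bij_betw_combine bL bM bR) auto
  moreover have "L \<union> M \<union> ?R = {1..t}" "L' \<union> M' \<union> ?R' = {1..t}" using sub by auto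
  ultimately have "\<sigma> permutes {1..t}"
    using sub by (intro bij_imp_permutes) (auto simp: \<sigma>_def)
  then show thesis
    using that bL bM by (auto simp: bij_betw_def)
qed

text \<open>
  Transitivity turns the average over all disjoint pairs into the exact value for each pair:
  composition with a permutation that carries one pair to another matches the
  permutations counted for the two pairs.
\<close>

lemma card_separating_permutations:
  assumes p: "p \<in> disjoint_pairs t r w"
  shows "card {\<pi>. \<pi> permutes {1..t} \<and> separates {i \<in> {1..t}. \<pi> i \<in> S} p} *
      card (disjoint_pairs t r w) = fact t * card {q \<in> disjoint_pairs t r w. separates S q}"
proof -
  let ?P = "disjoint_pairs t r w"
  let ?Pi = "{\<pi>. \<pi> permutes {1..t}}"
  let ?S = "\<lambda>\<pi>. {i \<in> {1..t}. \<pi> i \<in> S}"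
  let ?N = "\<lambda>q. {\<pi> \<in> ?Pi. separates (?S \<pi>) q}"
  have sep: "separates (?S \<pi>) (L, M) \<longleftrightarrow> separates S (\<pi> ` L, \<pi> ` M)"
    if "(L, M) \<in> ?P" for \<pi> L M
  proof -
    have "L \<subseteq> {1..t}" "M \<subseteq> {1..t}"
      using that by (auto simp: disjoint_pairs_def subsets_of_size_def)
    then show ?thesis unfolding separates_def fst_conv snd_conv by blast
  qed
  have finPi: "finite ?Pi" by (simp add: finite_permutations)
  \<comment> \<open>One inequality suffices for constancy, since \<open>q\<close> and \<open>q'\<close> may be exchanged.\<close>
  have le: "card (?N q) \<le> card (?N q')" if q: "q \<in> ?P" "q' \<in> ?P" for q q'
  proof -
    obtain L M L' M' where LM: "q = (L, M)" "q' = (L', M')" by fastforce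
    obtain \<sigma> where \<sigma>: "\<sigma> permutes {1..t}" "\<sigma> ` L' = L" "\<sigma> ` M' = M"
      using permutation_between_disjoint_pairs q LM by metis
    show ?thesis
    proof (rule card_inj_on_le)
      show "inj_on (\<lambda>\<pi>. \<pi> \<circ> \<sigma>) (?N q)"
        by (rule inj_on_inverseI[where g = "\<lambda>\<pi>. \<pi> \<circ> inv \<sigma>"])
          (simp add: comp_assoc permutes_inv_o(1)[OF \<sigma>(1)])
      show "(\<lambda>\<pi>. \<pi> \<circ> \<sigma>) ` ?N q \<subseteq> ?N q'"
        using q \<sigma> sep permutes_compose[OF \<sigma>(1)] unfolding LM
        by (auto simp: image_image)
      show "finite (?N q')" using finPi by simp
    qed
  qed
  \<comment> \<open>Every permutation, as a point, separates as many pairs as \<open>S\<close> does: it maps the ones onto the others.\<close>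
  have image_pair: "card {q \<in> ?P. separates (?S \<pi>) q} = card {q \<in> ?P. separates S q}"
    if \<pi>: "\<pi> permutes {1..t}" for \<pi>
  proof (rule bij_betw_same_card)
    have mem: "(\<tau> ` L, \<tau> ` M) \<in> ?P" if "\<tau> permutes {1..t}" "(L, M) \<in> ?P" for \<tau> L M
    proof -
      have "inj \<tau>" using that(1) by (rule permutes_inj)
      moreover have "\<tau> ` L \<subseteq> {1..t}" "\<tau> ` M \<subseteq> {1..t}"
        using that permutes_image[OF that(1)]
        by (auto simp: disjoint_pairs_def subsets_of_size_def permutes_in_image)
      ultimately show ?thesis
        using that(2) unfolding disjoint_pairs_def subsets_of_size_def
        by (auto simp: card_image inj_on_subset dest: injD)
    qed
    have inv: "inv \<pi> permutes {1..t}" using \<pi> by (rule permutes_inv)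
    have cancel: "\<pi> ` inv \<pi> ` A = A" "inv \<pi> ` \<pi> ` A = A" for A
      using permutes_inverses[OF \<pi>] by (auto simp: image_comp)
    show "bij_betw (\<lambda>(L, M). (\<pi> ` L, \<pi> ` M))
        {q \<in> ?P. separates (?S \<pi>) q} {q \<in> ?P. separates S q}"
      by (rule bij_betw_byWitness[where f' = "\<lambda>(L, M). (inv \<pi> ` L, inv \<pi> ` M)"])
        (auto simp: cancel sep[simplified] mem[OF \<pi>] mem[OF inv])
  qed
  have "card (?N p) * card ?P = (\<Sum>q\<in>?P. card (?N q))"
    using le p by (simp add: le_antisym sum.cong[where h = "\<lambda>_. card (?N p)"] mult.commute)
  also have "\<dots> = (\<Sum>\<pi>\<in>?Pi. card {q \<in> ?P. separates (?S \<pi>) q})"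
    by (rule sum_card_filter_swap[OF finPi finite_disjoint_pairs])
  also have "\<dots> = fact t * card {q \<in> ?P. separates S q}"
    using image_pair by (simp add: card_permutations)
  finally show ?thesis by simp
qed

text \<open>
  The minimum ranges over families whose points are natural numbers, whereas the points of the
  extremal family below are pairs of a permutation and an index.
\<close>

lemma cover_free_family_relabel:
  assumes cff: "cover_free_family r w d n t X B" and "0 < r"
  shows "\<exists>(X' :: nat set) B'. cover_free_family r w d n t X' B'"
proof -
  note X = cff[unfolded cover_free_family_iff_separating_points[OF \<open>0 < r\<close>]]
  have "finite X" using X by (rule conjunct1)
  from finite_imp_inj_to_nat_seg[OF this] obtain f :: "_ \<Rightarrow> nat" where f: "inj_on f X"
    by blast
  \<comment> \<open>\<open>f\<close> can be inverted on \<open>X\<close> only, and blocks with an index outside \<open>[t]\<close> may leave \<open>X\<close>.\<close>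
  let ?B = "\<lambda>i. f ` (B i \<inter> X)"
  have mem: "f x \<in> ?B i \<longleftrightarrow> x \<in> B i" if "x \<in> X" for x i
    using that f by (auto dest: inj_onD)
  have "card {y \<in> f ` X. separates {i \<in> {1..t}. y \<in> ?B i} p}
      = card {x \<in> X. separates {i \<in> {1..t}. x \<in> B i} p}" for p
  proof -
    have "{y \<in> f ` X. separates {i \<in> {1..t}. y \<in> ?B i} p}
        = f ` {x \<in> X. separates {i \<in> {1..t}. x \<in> B i} p}"
      using mem by (auto 0 3 simp: image_iff cong: conj_cong)
    then show ?thesis using f by (simp add: card_image inj_on_subset)
  qed
  then have "cover_free_family r w d n t (f ` X) ?B"
    using X f unfolding cover_free_family_iff_separating_points[OF \<open>0 < r\<close>]
    by (auto simp: card_image)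
  then show ?thesis by blast
qed

text \<open>
  The preimage of \<open>S\<close> under \<open>\<pi>\<close> is the set of indices of the blocks that contain the point
  \<open>(\<pi>, j)\<close>, so the points run through all preimages of \<open>S\<close>, and the hypothesis says that
  \<open>d\<close> is the average number of permutations that separate a pair.
\<close>

lemma permutation_cover_free_family:
  fixes d :: real
  assumes "0 < r"
    and dc: "d * card (disjoint_pairs t r w)
      = fact t * real (card {q \<in> disjoint_pairs t r w. separates S q})"
  shows "cover_free_family r w (real c * d) (c * fact t) t
     ({\<pi>. \<pi> permutes {1..t}} \<times> {..<c}) (\<lambda>i. {\<pi>. \<pi> permutes {1..t} \<and> \<pi> i \<in> S} \<times> {..<c})"
proof -
  let ?P = "disjoint_pairs t r w"
  let ?X = "{\<pi>. \<pi> permutes {1..t}} \<times> {..<c}"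
  let ?B = "\<lambda>i. {\<pi>. \<pi> permutes {1..t} \<and> \<pi> i \<in> S} \<times> {..<c}"
  have "real c * d = real (card {x \<in> ?X. separates {i \<in> {1..t}. x \<in> ?B i} p})"
    if p: "p \<in> ?P" for p
  proof -
    let ?N = "{\<pi>. \<pi> permutes {1..t} \<and> separates {i \<in> {1..t}. \<pi> i \<in> S} p}"
    have "?P \<noteq> {}" using p by blast
    then have pos: "0 < card ?P" using finite_disjoint_pairs by (simp add: card_gt_0_iff)
    have "real (card ?N) * card ?P = d * card ?P"
      using arg_cong[OF card_separating_permutations[OF p], of real]
      unfolding of_nat_mult of_nat_fact dc .
    then have "d = card ?N" using pos by simp
    moreover have "{x \<in> ?X. separates {i \<in> {1..t}. x \<in> ?B i} p} = ?N \<times> {..<c}"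
      by (auto simp: separates_def)
    ultimately show ?thesis by (simp add: card_cartesian_product)
  qed
  then show ?thesis
    unfolding cover_free_family_iff_separating_points[OF \<open>0 < r\<close>]
    by (auto simp: card_cartesian_product card_permutations finite_permutations)
qed

section \<open>The minimum size\<close>

theorem theorem4:
  fixes r w t d\<^sub>0 :: nat and d :: real
  assumes "0 < r" and "0 < w" and "0 < t" and "0 < d\<^sub>0"
    and "w \<le> r" and "r + w \<le> t"
    and "d = real (max_biclique_edges (bi_intersection_graph t r w))
           / real (card (edges (bi_intersection_graph t r w))) * fact t"
  shows "cff_number r w (real d\<^sub>0 * d) t = d\<^sub>0 * fact t"
proof -
  let ?P = "disjoint_pairs t r w"
  let ?b = "max_biclique_edges (bi_intersection_graph t r w)"
  have posP: "0 < card ?P"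
    using disjoint_pairs_nonempty[OF assms(6)] finite_disjoint_pairs by (simp add: card_gt_0_iff)
  have dP: "d * card ?P = fact t * real ?b"
    using assms(7) posP by (simp add: card_edges_bi_intersection_graph)
  obtain S where S: "?b = card {q \<in> ?P. separates S q}"
    by (rule max_biclique_eq_card_separated)
  show ?thesis
    unfolding cff_number_def
  proof (rule Least_equality)
    show "\<exists>(X :: nat set) B. cover_free_family r w (real d\<^sub>0 * d) (d\<^sub>0 * fact t) t X B"
      using dP unfolding S
      by (rule cover_free_family_relabel[OF permutation_cover_free_family[OF assms(1)] assms(1)])
  next
    fix n assume "\<exists>(X :: nat set) B. cover_free_family r w (real d\<^sub>0 * d) n t X B"
    then obtain X :: "nat set" and B where "cover_free_family r w (real d\<^sub>0 * d) n t X B" by blast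
    from cover_free_family_size_bound[OF this assms(1)]
    have "real d\<^sub>0 * (d * card ?P) \<le> real n * ?b" by (simp add: mult.assoc)
    then have "real (d\<^sub>0 * fact t) * ?b \<le> real n * ?b"
      unfolding dP by (simp add: mult.assoc)
    then show "d\<^sub>0 * fact t \<le> n"
      using max_biclique_pos[OF assms(6)] by (simp only: mult_le_cancel_right of_nat_le_iff)
  qed
qed

end
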